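(* Let $\mathcal H_+=\mathcal A+\mathcal B$ and $\mathcal H_-=\mathcal A-\mathcal B$ be the operators built from a real-valued ground state (see context). Assume that $\{\omega_i;\boldsymbol f_i,\boldsymbol g_i\}$, $i=1,2$, with $\omega_i\in\mathbb R$, are eigenpairs of $$\begin{bmatrix}\mathcal O&\mathcal H_-\\ \mathcal H_+&\mathcal O\end{bmatrix}\begin{bmatrix}\boldsymbol f\\ \boldsymbol g\end{bmatrix}=\omega\begin{bmatrix}\boldsymbol f\\ \boldsymbol g\end{bmatrix}$$ with eigenvalues of different magnitudes, $|\omega_1|\neq|\omega_2|$. Then $$\langle\boldsymbol f_1,\boldsymbol g_2\rangle=\langle\boldsymbol f_2,\boldsymbol g_1\rangle=0 .$$
   Context: Let $d\in\{1,2,3\}$, $V:\mathbb R^d\to\mathbb R$ a real-valued potential, $\delta\in\mathbb R$, $\Omega\in\mathbb R\setminus\{0\}$, $\beta_{jl}\in\mathbb R$ ($j,l=1,2$) with $\beta_{12}=\beta_{21}$. The ground state $\Phi_g=(\phi_1,\phi_2)^\top$ minimizes, over $\mathbb C^2$-valued $\Phi$ with finite energy and $\int(|\phi_1|^2+|\phi_2|^2)=1$, the energy $$\mathcal E_\Omega(\Phi)=\int_{\mathbb R^d}\sum_j\Big(\tfrac12|\nabla\phi_j|^2+V|\phi_j|^2\Big)+\sum_{j,l}\tfrac{\beta_{jl}}2|\phi_j|^2|\phi_l|^2+\tfrac\delta2(|\phi_1|^2-|\phi_2|^2)+\Omega\,\mathrm{Re}(\phi_1\overline{\phi_2})\,d\boldsymbol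 x .$$ It is assumed real-valued; $\mu\in\mathbb R$ is its chemical potential, i.e. $$\mu\phi_1=[-\tfrac12\nabla^2+V+\tfrac\delta2+\beta_{11}\phi_1^2+\beta_{12}\phi_2^2]\phi_1+\tfrac\Omega2\phi_2,\qquad \mu\phi_2=[-\tfrac12\nabla^2+V-\tfrac\delta2+\beta_{21}\phi_1^2+\beta_{22}\phi_2^2]\phi_2+\tfrac\Omega2\phi_1.$$ Put $$\mathcal A=\begin{bmatrix}L_1&\beta_{12}\phi_1\phi_2+\frac\Omega2\\ \beta_{21}\phi_1\phi_2+\frac\Omega2&L_2\end{bmatrix},\qquad \mathcal B=\begin{bmatrix}\beta_{11}\phi_1^2&\beta_{12}\phi_1\phi_2\\ \beta_{21}\phi_1\phi_2&\beta_{22}\phi_2^2\end{bmatrix},$$ $$L_1=-\tfrac12\nabla^2+V+\tfrac\delta2+2\beta_{11}\phi_1^2+\beta_{12}\phi_2^2-\mu,\qquad L_2=-\tfrac12\nabla^2+V-\tfrac\delta2+\beta_{21}\phi_1^2+2\beta_{22}\phi_2^2-\mu.$$ The inner product of $\mathbb C^2$-valued functions is $\langle\boldsymbol f,\boldsymbol g\rangle=\sum_{j=1,2}\int_{\mathbb R^d}f_j\overline{g_j}\,d\boldsymbol x$. The functions $\phi_j$ and the components of $\boldsymbol f_i,\boldsymbol g_i$ are smooth and fast-decaying (Schwartz functions). *)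

theory Defs
  imports "HOL-Analysis.Analysis"
begin

definition pderiv_at :: "'n \<Rightarrow> (real^'n::finite \<Rightarrow> 'b::real_normed_vector) \<Rightarrow> real^'n \<Rightarrow> 'b"
  where "pderiv_at i f x = frechet_derivative f (at x) (axis i 1)"

fun iter_pderiv :: "'n list \<Rightarrow> (real^'n::finite \<Rightarrow> 'b::real_normed_vector) \<Rightarrow> real^'n \<Rightarrow> 'b"
  where
    "iter_pderiv [] f = f"
  | "iter_pderiv (i # is) f = pderiv_at i (iter_pderiv is f)"

definition smooth :: "(real^'n::finite \<Rightarrow> 'b::real_normed_vector) \<Rightarrow> bool"
  where "smooth f \<longleftrightarrow> (\<forall>is x. iter_pderiv is f differentiable (at x))"

definition schwartz :: "(real^'n::finite \<Rightarrow> 'b::real_normed_vector) \<Rightarrow> bool"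
  where "schwartz f \<longleftrightarrow>
    smooth f \<and> (\<forall>is k. bounded (range (\<lambda>x. norm x ^ k *\<^sub>R iter_pderiv is f x)))"

definition laplacian :: "(real^'n::finite \<Rightarrow> 'b::real_normed_vector) \<Rightarrow> real^'n \<Rightarrow> 'b"
  where "laplacian f x = (\<Sum>i\<in>UNIV. pderiv_at i (pderiv_at i f) x)"

definition test_function :: "(real^'n::finite \<Rightarrow> real) \<Rightarrow> bool"
  where "test_function \<psi> \<longleftrightarrow> smooth \<psi> \<and> (\<exists>K. compact K \<and> (\<forall>x. x \<notin> K \<longrightarrow> \<psi> x = 0))"

definition locally_integrable :: "(real^'n::finite \<Rightarrow> complex) \<Rightarrow> bool"
  where "locally_integrable u \<longleftrightarrow> (\<forall>K. compact K \<longrightarrow> set_integrable lebesgue K u)"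

definition has_weak_gradient ::
    "(real^'n::finite \<Rightarrow> complex) \<Rightarrow> (real^'n \<Rightarrow> complex^'n) \<Rightarrow> bool"
  where "has_weak_gradient u G \<longleftrightarrow>
    locally_integrable u \<and>
    (\<forall>i. locally_integrable (\<lambda>x. G x $ i)) \<and>
    (\<forall>\<psi> i. test_function \<psi> \<longrightarrow>
      (LINT x|lebesgue. pderiv_at i \<psi> x *\<^sub>R u x) = - (LINT x|lebesgue. \<psi> x *\<^sub>R (G x $ i)))"

text \<open>A weak gradient is unique only up to null sets; \<open>weak_gradient\<close> selects a
  representative, and is used only under an integral.\<close>

definition weak_gradient :: "(real^'n::finite \<Rightarrow> complex) \<Rightarrow> real^'n \<Rightarrow> complex^'n"
  where "weak_gradient u = (SOME G. has_weak_gradient u G)"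

text \<open>The Bochner integral of a non-integrable function is 0, so finiteness of the energy is
  the explicit requirement that every term of the energy density be integrable.\<close>

definition finite_energy ::
    "(real^'n::finite \<Rightarrow> real) \<Rightarrow> (real^'n \<Rightarrow> complex^2) \<Rightarrow> bool"
  where "finite_energy V \<Phi> \<longleftrightarrow>
    (\<forall>j. (\<lambda>x. \<Phi> x $ j) \<in> borel_measurable lebesgue \<and>
         integrable lebesgue (\<lambda>x. (cmod (\<Phi> x $ j))\<^sup>2) \<and>
         (\<exists>G. has_weak_gradient (\<lambda>x. \<Phi> x $ j) G) \<and>
         integrable lebesgue (\<lambda>x. (norm (weak_gradient (\<lambda>y. \<Phi> y $ j) x))\<^sup>2) \<and>
         integrable lebesgue (\<lambda>x. V x * (cmod (\<Phi> x $ j))\<^sup>2)) \<and>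
    (\<forall>j l. integrable lebesgue (\<lambda>x. (cmod (\<Phi> x $ j))\<^sup>2 * (cmod (\<Phi> x $ l))\<^sup>2))"

definition energy ::
    "(real^'n::finite \<Rightarrow> real) \<Rightarrow> real \<Rightarrow> real \<Rightarrow> real^2^2 \<Rightarrow> (real^'n \<Rightarrow> complex^2) \<Rightarrow> real"
  where "energy V \<delta> \<Omega> \<beta> \<Phi> =
    (LINT x|lebesgue.
      (\<Sum>j\<in>UNIV. (1/2) * (norm (weak_gradient (\<lambda>y. \<Phi> y $ j) x))\<^sup>2
                  + V x * (cmod (\<Phi> x $ j))\<^sup>2)
      + (\<Sum>j\<in>UNIV. \<Sum>l\<in>UNIV. (\<beta> $ j $ l / 2) * (cmod (\<Phi> x $ j))\<^sup>2 * (cmod (\<Phi> x $ l))\<^sup>2)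
      + (\<delta>/2) * ((cmod (\<Phi> x $ 1))\<^sup>2 - (cmod (\<Phi> x $ 2))\<^sup>2)
      + \<Omega> * Re (\<Phi> x $ 1 * cnj (\<Phi> x $ 2)))"

definition mass :: "(real^'n::finite \<Rightarrow> complex^2) \<Rightarrow> real"
  where "mass \<Phi> = (LINT x|lebesgue. (cmod (\<Phi> x $ 1))\<^sup>2 + (cmod (\<Phi> x $ 2))\<^sup>2)"

definition ground_state ::
    "(real^'n::finite \<Rightarrow> real) \<Rightarrow> real \<Rightarrow> real \<Rightarrow> real^2^2 \<Rightarrow> (real^'n \<Rightarrow> complex^2) \<Rightarrow> bool"
  where "ground_state V \<delta> \<Omega> \<beta> \<Phi> \<longleftrightarrow>
    finite_energy V \<Phi> \<and> mass \<Phi> = 1 \<and>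
    (\<forall>\<Psi>. finite_energy V \<Psi> \<longrightarrow> mass \<Psi> = 1 \<longrightarrow> energy V \<delta> \<Omega> \<beta> \<Phi> \<le> energy V \<delta> \<Omega> \<beta> \<Psi>)"

definition complexify :: "(real^'n::finite \<Rightarrow> real^2) \<Rightarrow> real^'n \<Rightarrow> complex^2"
  where "complexify \<phi> x = (\<chi> j. complex_of_real (\<phi> x $ j))"

definition chemical_potential ::
    "(real^'n::finite \<Rightarrow> real) \<Rightarrow> real \<Rightarrow> real \<Rightarrow> real^2^2 \<Rightarrow> (real^'n \<Rightarrow> real^2) \<Rightarrow> real \<Rightarrow> bool"
  where "chemical_potential V \<delta> \<Omega> \<beta> \<phi> \<mu> \<longleftrightarrow>
    (\<forall>x. \<mu> * \<phi> x $ 1 =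
         - (1/2) * laplacian (\<lambda>y. \<phi> y $ 1) x
         + (V x + \<delta>/2 + \<beta>$1$1 * (\<phi> x $ 1)\<^sup>2 + \<beta>$1$2 * (\<phi> x $ 2)\<^sup>2) * \<phi> x $ 1
         + (\<Omega>/2) * \<phi> x $ 2) \<and>
    (\<forall>x. \<mu> * \<phi> x $ 2 =
         - (1/2) * laplacian (\<lambda>y. \<phi> y $ 2) x
         + (V x - \<delta>/2 + \<beta>$2$1 * (\<phi> x $ 1)\<^sup>2 + \<beta>$2$2 * (\<phi> x $ 2)\<^sup>2) * \<phi> x $ 2
         + (\<Omega>/2) * \<phi> x $ 1)"

definition L1_op ::
    "(real^'n::finite \<Rightarrow> real) \<Rightarrow> real \<Rightarrow> real^2^2 \<Rightarrow> (real^'n \<Rightarrow> real^2) \<Rightarrow> real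
      \<Rightarrow> (real^'n \<Rightarrow> complex) \<Rightarrow> real^'n \<Rightarrow> complex"
  where "L1_op V \<delta> \<beta> \<phi> \<mu> u x =
    - (1/2) * laplacian u x
    + complex_of_real (V x + \<delta>/2 + 2 * \<beta>$1$1 * (\<phi> x $ 1)\<^sup>2 + \<beta>$1$2 * (\<phi> x $ 2)\<^sup>2 - \<mu>) * u x"

definition L2_op ::
    "(real^'n::finite \<Rightarrow> real) \<Rightarrow> real \<Rightarrow> real^2^2 \<Rightarrow> (real^'n \<Rightarrow> real^2) \<Rightarrow> real
      \<Rightarrow> (real^'n \<Rightarrow> complex) \<Rightarrow> real^'n \<Rightarrow> complex"
  where "L2_op V \<delta> \<beta> \<phi> \<mu> u x =
    - (1/2) * laplacian u x
    + complex_of_real (V x - \<delta>/2 + \<beta>$2$1 * (\<phi> x $ 1)\<^sup>2 + 2 * \<beta>$2$2 * (\<phi> x $ 2)\<^sup>2 - \<mu>) * u x"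

definition A_op ::
    "(real^'n::finite \<Rightarrow> real) \<Rightarrow> real \<Rightarrow> real \<Rightarrow> real^2^2 \<Rightarrow> (real^'n \<Rightarrow> real^2) \<Rightarrow> real
      \<Rightarrow> (real^'n \<Rightarrow> complex^2) \<Rightarrow> real^'n \<Rightarrow> complex^2"
  where "A_op V \<delta> \<Omega> \<beta> \<phi> \<mu> f x = vector
    [L1_op V \<delta> \<beta> \<phi> \<mu> (\<lambda>y. f y $ 1) x
       + complex_of_real (\<beta>$1$2 * \<phi> x $ 1 * \<phi> x $ 2 + \<Omega>/2) * f x $ 2,
     complex_of_real (\<beta>$2$1 * \<phi> x $ 1 * \<phi> x $ 2 + \<Omega>/2) * f x $ 1
       + L2_op V \<delta> \<beta> \<phi> \<mu> (\<lambda>y. f y $ 2) x]"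

definition B_op ::
    "real^2^2 \<Rightarrow> (real^'n::finite \<Rightarrow> real^2) \<Rightarrow> (real^'n \<Rightarrow> complex^2) \<Rightarrow> real^'n \<Rightarrow> complex^2"
  where "B_op \<beta> \<phi> f x = vector
    [complex_of_real (\<beta>$1$1 * (\<phi> x $ 1)\<^sup>2) * f x $ 1
       + complex_of_real (\<beta>$1$2 * \<phi> x $ 1 * \<phi> x $ 2) * f x $ 2,
     complex_of_real (\<beta>$2$1 * \<phi> x $ 1 * \<phi> x $ 2) * f x $ 1
       + complex_of_real (\<beta>$2$2 * (\<phi> x $ 2)\<^sup>2) * f x $ 2]"

definition H_plus ::
    "(real^'n::finite \<Rightarrow> real) \<Rightarrow> real \<Rightarrow> real \<Rightarrow> real^2^2 \<Rightarrow> (real^'n \<Rightarrow> real^2) \<Rightarrow> real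
      \<Rightarrow> (real^'n \<Rightarrow> complex^2) \<Rightarrow> real^'n \<Rightarrow> complex^2"
  where "H_plus V \<delta> \<Omega> \<beta> \<phi> \<mu> f x = A_op V \<delta> \<Omega> \<beta> \<phi> \<mu> f x + B_op \<beta> \<phi> f x"

definition H_minus ::
    "(real^'n::finite \<Rightarrow> real) \<Rightarrow> real \<Rightarrow> real \<Rightarrow> real^2^2 \<Rightarrow> (real^'n \<Rightarrow> real^2) \<Rightarrow> real
      \<Rightarrow> (real^'n \<Rightarrow> complex^2) \<Rightarrow> real^'n \<Rightarrow> complex^2"
  where "H_minus V \<delta> \<Omega> \<beta> \<phi> \<mu> f x = A_op V \<delta> \<Omega> \<beta> \<phi> \<mu> f x - B_op \<beta> \<phi> f x"

definition block_op ::
    "(real^'n::finite \<Rightarrow> real) \<Rightarrow> real \<Rightarrow> real \<Rightarrow> real^2^2 \<Rightarrow> (real^'n \<Rightarrow> real^2) \<Rightarrow> real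
      \<Rightarrow> (real^'n \<Rightarrow> complex^2) \<times> (real^'n \<Rightarrow> complex^2)
      \<Rightarrow> (real^'n \<Rightarrow> complex^2) \<times> (real^'n \<Rightarrow> complex^2)"
  where "block_op V \<delta> \<Omega> \<beta> \<phi> \<mu> = (\<lambda>(f, g). (H_minus V \<delta> \<Omega> \<beta> \<phi> \<mu> g, H_plus V \<delta> \<Omega> \<beta> \<phi> \<mu> f))"

definition block_eigenpair ::
    "(real^'n::finite \<Rightarrow> real) \<Rightarrow> real \<Rightarrow> real \<Rightarrow> real^2^2 \<Rightarrow> (real^'n \<Rightarrow> real^2) \<Rightarrow> real
      \<Rightarrow> real \<Rightarrow> (real^'n \<Rightarrow> complex^2) \<Rightarrow> (real^'n \<Rightarrow> complex^2) \<Rightarrow> bool"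
  where "block_eigenpair V \<delta> \<Omega> \<beta> \<phi> \<mu> \<omega> f g \<longleftrightarrow>
    (f, g) \<noteq> ((\<lambda>x. 0), (\<lambda>x. 0)) \<and>
    block_op V \<delta> \<Omega> \<beta> \<phi> \<mu> (f, g) = ((\<lambda>x. \<omega> *\<^sub>R f x), (\<lambda>x. \<omega> *\<^sub>R g x))"

definition inner_prod ::
    "(real^'n::finite \<Rightarrow> complex^2) \<Rightarrow> (real^'n \<Rightarrow> complex^2) \<Rightarrow> complex"
  where "inner_prod f g = (\<Sum>j\<in>UNIV. LINT x|lebesgue. f x $ j * cnj (g x $ j))"

end

theory Submission
  imports Defs
begin

text \<open>
  Both \<open>H_plus\<close> and \<open>H_minus\<close> are symmetric on Schwartz functions. Since an eigenpair satisfies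
  \<open>H_minus g = \<omega> f\<close> and \<open>H_plus f = \<omega> g\<close>, symmetry yields
  \<open>\<omega>\<^sub>1 \<langle>f\<^sub>1, g\<^sub>2\<rangle> = \<omega>\<^sub>2 \<langle>g\<^sub>1, f\<^sub>2\<rangle>\<close> and \<open>\<omega>\<^sub>2 \<langle>f\<^sub>1, g\<^sub>2\<rangle> = \<omega>\<^sub>1 \<langle>g\<^sub>1, f\<^sub>2\<rangle>\<close>,
  a linear system with determinant \<open>\<omega>\<^sub>2\<^sup>2 - \<omega>\<^sub>1\<^sup>2 \<noteq> 0\<close>.
  For the symmetry, all zeroth-order terms, including the possibly unbounded \<open>V\<close>, cancel pointwise in
  \<open>(H u) \<sqdot> cnj v - u \<sqdot> cnj (H v)\<close>; what remains is a sum of partial derivatives of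
  integrable functions, whose integrals vanish by translation invariance of Lebesgue measure.
\<close>

section \<open>Integrability from polynomial decay\<close>

text \<open>Where \<open>norm x\<close> has integer part k, the integrand is at most (1 + k)^-(d +
  2), with d the dimension, and x lies in the ball of radius 1 + k, whose volume is a constant times
  (1 + k)^d. The two powers beyond d leave the convergent series of 1 / (1 + k)^2.\<close>

lemma integrable_inverse_one_plus_norm_power:
  "integrable lborel (\<lambda>x::'a::euclidean_space. 1 / (1 + norm x) ^ (DIM('a) + 2))"
proof -
  let ?m = "DIM('a) + 2"
  let ?c = "unit_ball_vol (real DIM('a))"
  have le: "ennreal (1 / (1 + norm x) ^ ?m)
      \<le> (\<Sum>k. ennreal (1 / (1 + real k) ^ ?m) * indicator (cball 0 (1 + real k)) x)" for x :: 'a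
  proof -
    define k where "k = nat \<lfloor>norm x\<rfloor>"
    have k: "real k \<le> norm x" "norm x \<le> 1 + real k"
      unfolding k_def by (simp, linarith)
    have "1 / (1 + norm x) ^ ?m \<le> 1 / (1 + real k) ^ ?m"
      using k by (intro divide_left_mono power_mono mult_pos_pos zero_less_power) (auto intro: add_pos_nonneg)
    then have "ennreal (1 / (1 + norm x) ^ ?m)
        \<le> ennreal (1 / (1 + real k) ^ ?m) * indicator (cball 0 (1 + real k)) x"
      using k by (simp add: indicator_def ennreal_leI)
    \<comment> \<open>All terms are nonnegative, so the series dominates its single term for the
      chosen \<open>k\<close>.\<close>
    also have "\<dots> \<le> (\<Sum>k. ennreal (1 / (1 + real k) ^ ?m) * indicator (cball 0 (1 + real k)) x)"
      using sum_le_suminf[OF summableI, of "{k}"]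
      by (metis (lifting) finite.emptyI finite.insertI sum.insert sum.empty empty_iff add_0_right zero_le)
    finally show ?thesis .
  qed
  have "(\<integral>\<^sup>+x. ennreal (1 / (1 + norm (x::'a)) ^ ?m) \<partial>lborel)
      \<le> (\<integral>\<^sup>+x. (\<Sum>k. ennreal (1 / (1 + real k) ^ ?m) * indicator (cball (0::'a) (1 + real k)) x) \<partial>lborel)"
    by (intro nn_integral_mono le)
  also have "\<dots> = (\<Sum>k. \<integral>\<^sup>+x. ennreal (1 / (1 + real k) ^ ?m) * indicator (cball (0::'a) (1 + real k)) x \<partial>lborel)"
    by (intro nn_integral_suminf borel_measurable_times_ennreal borel_measurable_const borel_measurable_indicator)
      simp
  also have "\<dots> = (\<Sum>k. ennreal (1 / (1 + real k) ^ ?m) * emeasure lborel (cball (0::'a) (1 + real k)))"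
    by (simp add: nn_integral_cmult_indicator)
  also have "\<dots> = (\<Sum>k. ennreal (?c * (1 / real (Suc k) ^ 2)))"
  proof (intro suminf_cong)
    fix k
    have "ennreal (1 / (1 + real k) ^ ?m) * emeasure lborel (cball (0::'a) (1 + real k))
        = ennreal (1 / (1 + real k) ^ ?m * (?c * (1 + real k) ^ DIM('a)))"
      by (subst emeasure_cball) (simp_all only: ennreal_mult[symmetric] unit_ball_vol_nonneg of_nat_0_le_iff
          zero_le_power zero_le_divide_iff zero_le_one add_nonneg_nonneg mult_nonneg_nonneg simp_thms)
    also have "1 / (1 + real k) ^ ?m * (?c * (1 + real k) ^ DIM('a)) = ?c * (1 / real (Suc k) ^ 2)"
    proof -
      have "1 / r ^ ?m * (?c * r ^ DIM('a)) = ?c * (1 / r ^ 2)" if "r \<noteq> 0" for r :: real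
        using that by (simp add: power_add power2_eq_square)
      from this[of "real (Suc k)"] show ?thesis by (simp only: of_nat_Suc)
    qed
    finally show "ennreal (1 / (1 + real k) ^ ?m) * emeasure lborel (cball (0::'a) (1 + real k))
        = ennreal (?c * (1 / real (Suc k) ^ 2))" .
  qed
  also have "\<dots> < \<infinity>"
  proof -
    have "summable (\<lambda>k. 1 / real (Suc k) ^ 2)"
      using inverse_squares_sums by (auto simp: sums_iff add.commute)
    then have "summable (\<lambda>k. ?c * (1 / real (Suc k) ^ 2))"
      by (rule summable_mult)
    then show ?thesis
      by (subst suminf_ennreal2) auto
  qed
  finally show ?thesis
    by (intro integrableI_nonneg) (auto intro!: AE_I2)
qed

text \<open>The decay bounds for the powers 0 and \<open>DIM('a) + 2\<close> combine to domination
  by a multiple of the integrable weight above.\<close>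

lemma integrable_if_polynomial_decay:
  fixes f :: "'a::euclidean_space \<Rightarrow> 'b::{banach, second_countable_topology}"
  assumes "continuous_on UNIV f"
    and "\<And>k. bounded (range (\<lambda>x. norm x ^ k *\<^sub>R f x))"
  shows "integrable lborel f"
proof -
  let ?m = "DIM('a) + 2"
  obtain A where A: "\<And>x. norm (f x) \<le> A"
    using assms(2)[of 0] by (auto simp: bounded_iff)
  obtain B where B: "\<And>x. norm x ^ ?m * norm (f x) \<le> B"
    using assms(2)[of ?m] by (auto simp: bounded_iff)
  have bound: "norm (f x) \<le> 2 ^ ?m * (A + B) * (1 / (1 + norm x) ^ ?m)" for x
  proof -
    have nonneg: "0 \<le> A" "0 \<le> B"
      using order_trans[OF norm_ge_zero A] B[of 0] by auto
    \<comment> \<open>Since 1 + r \<le> 2 max(1, r), the bound \<open>A\<close> handles the unit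
      ball and \<open>B\<close> its complement.\<close>
    have "(1 + norm x) ^ ?m \<le> (2 * max 1 (norm x)) ^ ?m"
      by (intro power_mono) auto
    then have "(1 + norm x) ^ ?m * norm (f x) \<le> 2 ^ ?m * (max 1 (norm x) ^ ?m * norm (f x))"
      unfolding power_mult_distrib by (metis mult.assoc mult_right_mono norm_ge_zero)
    also have "max 1 (norm x) ^ ?m * norm (f x) \<le> A + B"
    proof (cases "norm x \<le> 1")
      case True
      then show ?thesis using A[of x] nonneg by (simp add: max_def)
    next
      case False
      then have "max 1 (norm x) = norm x" by simp
      then show ?thesis using B[of x] nonneg by simp
    qed
    finally have *: "(1 + norm x) ^ ?m * norm (f x) \<le> 2 ^ ?m * (A + B)"
      by simp
    have "0 < (1 + norm x) ^ ?m"
      by (intro zero_less_power add_pos_nonneg) auto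
    with * show ?thesis
      by (simp add: pos_le_divide_eq mult.commute del: power_Suc power_add)
  qed
  show ?thesis
  proof (rule Bochner_Integration.integrable_bound)
    show "integrable lborel (\<lambda>x::'a. 2 ^ ?m * (A + B) * (1 / (1 + norm x) ^ ?m))"
      by (intro integrable_mult_right integrable_inverse_one_plus_norm_power)
    show "f \<in> borel_measurable lborel"
      using borel_measurable_continuous_onI[OF assms(1)] by simp
    show "AE x in lborel. norm (f x) \<le> norm (2 ^ ?m * (A + B) * (1 / (1 + norm x) ^ ?m))"
    proof (intro AE_I2)
      fix x :: 'a
      have "norm (f x) \<le> 2 ^ ?m * (A + B) * (1 / (1 + norm x) ^ ?m)" by (rule bound)
      also have "\<dots> \<le> norm \<dots>" unfolding real_norm_def by (rule abs_ge_self)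
      finally show "norm (f x) \<le> norm (2 ^ ?m * (A + B) * (1 / (1 + norm x) ^ ?m))" .
    qed
  qed
qed

section \<open>Translation invariance and integrals of derivatives\<close>

lemma
  fixes f :: "'a::euclidean_space \<Rightarrow> 'b::{banach, second_countable_topology}"
  assumes "integrable lborel f"
  shows integrable_lborel_translate: "integrable lborel (\<lambda>x. f (x + a))"
    and integral_lborel_translate: "(LINT x|lborel. f (x + a)) = (LINT x|lborel. f x)"
proof -
  have d: "distr lborel borel (\<lambda>x. x + a) = lborel"
    using lborel_distr_plus[of a] by (simp only: add.commute[of _ a])
  have f: "f \<in> borel_measurable borel"
    using borel_measurable_integrable[OF assms] by simp
  have t: "(\<lambda>x. x + a) \<in> lborel \<rightarrow>\<^sub>M borel" by simp
  show "integrable lborel (\<lambda>x. f (x + a))"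
    using integrable_distr_eq[OF t f] assms by (simp add: d)
  show "(LINT x|lborel. f (x + a)) = (LINT x|lborel. f x)"
    using integral_distr[OF t f] by (simp add: d)
qed

text \<open>Integrate \<open>F (x + e\<^sub>i) - F x = \<integral>\<^sub>0\<^sup>1 \<partial>\<^sub>i F (x + t e\<^sub>i) dt\<close> over \<open>x\<close>: the left
  side gives 0 and, by Fubini, the right side gives \<open>\<integral> \<partial>\<^sub>i F\<close>.\<close>

lemma integral_directional_derivative_eq_0:
  fixes F D :: "'a::euclidean_space \<Rightarrow> 'b::euclidean_space"
  assumes deriv: "\<And>x t. ((\<lambda>t. F (x + t *\<^sub>R e)) has_vector_derivative D (x + t *\<^sub>R e)) (at t)"
    and cont: "continuous_on UNIV D"
    and intF: "integrable lborel F" and intD: "integrable lborel D"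
  shows "(LINT x|lborel. D x) = 0"
proof -
  \<comment> \<open>The indicator turns the integral over [0, 1] into one over the whole line, so
    that Fubini applies to a product of two copies of \<open>lborel\<close>.\<close>
  define K where "K = (\<lambda>t x. indicat_real {0..1} t *\<^sub>R D (x + t *\<^sub>R e))"
  have Dm: "D \<in> borel_measurable borel"
    using borel_measurable_continuous_onI[OF cont] .
  have meas: "case_prod K \<in> borel_measurable (lborel \<Otimes>\<^sub>M lborel)"
    unfolding K_def by (measurable, rule measurable_compose[OF _ Dm], measurable)
  have intK: "integrable (lborel \<Otimes>\<^sub>M lborel) (case_prod K)"
  proof (rule lborel_pair.Fubini_integrable[OF meas])
    \<comment> \<open>By translation invariance the norm of the slice at t in [0, 1] does not depend
      on t, which gives absolute integrability on the product.\<close>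
    have "(LINT x|lborel. norm (K t x)) = indicat_real {0..1} t * (LINT x|lborel. norm (D x))" for t
      using integral_lborel_translate[OF integrable_norm[OF intD], of "t *\<^sub>R e"]
      by (simp add: K_def)
    then show "integrable lborel (\<lambda>t. LINT x|lborel. norm (case (t, x) of (t, x) \<Rightarrow> K t x))"
      by (simp add: integrable_mult_left)
    show "AE t in lborel. integrable lborel (\<lambda>x. case (t, x) of (t, x) \<Rightarrow> K t x)"
      using integrable_lborel_translate[OF intD] by (simp add: K_def)
  qed
  have inner: "(LINT t|lborel. K t x) = F (x + e) - F x" for x
  proof -
    have "(LINT t|lborel. indicat_real {0..1} t *\<^sub>R D (x + t *\<^sub>R e)) = F (x + 1 *\<^sub>R e) - F (x + 0 *\<^sub>R e)"
    proof (rule integral_FTC_Icc)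
      show "((\<lambda>t. F (x + t *\<^sub>R e)) has_vector_derivative D (x + t *\<^sub>R e)) (at t within {0..1})" for t
        by (rule has_vector_derivative_at_within[OF deriv])
      show "continuous_on {0..1} (\<lambda>t. D (x + t *\<^sub>R e))"
        by (intro continuous_on_compose2[OF cont] continuous_intros) auto
    qed simp
    then show ?thesis by (simp add: K_def)
  qed
  \<comment> \<open>The inserted indicator integrates to 1, the length of the interval.\<close>
  have "(LINT x|lborel. D x) = (LINT t|lborel. indicat_real {0..1::real} t *\<^sub>R (LINT x|lborel. D x))"
    by simp
  also have "\<dots> = (LINT t|lborel. LINT x|lborel. K t x)"
    using integral_lborel_translate[OF intD] by (simp add: K_def)
  also have "\<dots> = (LINT x|lborel. LINT t|lborel. K t x)"
    using lborel_pair.Fubini_integral[OF intK] by simp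
  also have "\<dots> = (LINT x|lborel. F (x + e)) - (LINT x|lborel. F x)"
    unfolding inner
    by (intro Bochner_Integration.integral_diff integrable_lborel_translate intF)
  also have "\<dots> = 0"
    by (simp add: integral_lborel_translate[OF intF])
  finally show ?thesis .
qed

section \<open>Schwartz functions and Green's identity\<close>

text \<open>The head of the list is the outermost derivative, so a derivative taken first goes to
  the end. Hence the Schwartz bounds for \<open>f\<close> contain those for its partial
  derivatives.\<close>

lemma iter_pderiv_pderiv_at: "iter_pderiv is (pderiv_at i f) = iter_pderiv (is @ [i]) f"
  by (induction "is") auto

lemma schwartz_pderiv_at: "schwartz f \<Longrightarrow> schwartz (pderiv_at i f)"
  unfolding schwartz_def smooth_def by (simp add: iter_pderiv_pderiv_at)

lemma schwartz_differentiable: "schwartz f \<Longrightarrow> f differentiable (at x)"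
  unfolding schwartz_def smooth_def by (metis iter_pderiv.simps(1))

lemma schwartz_continuous_on: "schwartz f \<Longrightarrow> continuous_on UNIV f"
  by (meson continuous_at_imp_continuous_on differentiable_imp_continuous_within schwartz_differentiable)

lemma schwartz_bounded: "schwartz f \<Longrightarrow> bounded (range (\<lambda>x. norm x ^ k *\<^sub>R f x))"
  unfolding schwartz_def by (metis iter_pderiv.simps(1))

text \<open>The factor \<open>u\<close> absorbs the weight \<open>norm x ^ k\<close>, while
  \<open>v\<close> contributes a bounded factor.\<close>

lemma schwartz_integrable_mult_cnj:
  fixes u v :: "real^'n::finite \<Rightarrow> complex"
  assumes "schwartz u" "schwartz v"
  shows "integrable lborel (\<lambda>x. u x * cnj (v x))"
proof (rule integrable_if_polynomial_decay)
  show "continuous_on UNIV (\<lambda>x. u x * cnj (v x))"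
    by (intro continuous_intros schwartz_continuous_on assms)
  fix k
  obtain A where A: "\<And>x. norm x ^ k * norm (u x) \<le> A"
    using schwartz_bounded[OF assms(1), of k] by (auto simp: bounded_iff)
  obtain B where B: "\<And>x. norm (v x) \<le> B"
    using schwartz_bounded[OF assms(2), of 0] by (auto simp: bounded_iff)
  have "norm (norm x ^ k *\<^sub>R (u x * cnj (v x))) \<le> A * B" for x
  proof -
    have "norm x ^ k * norm (u x) * norm (v x) \<le> A * B"
      using A[of 0] by (intro mult_mono A B) (auto intro: order_trans[OF _ A])
    then show ?thesis by (simp add: norm_mult mult.assoc)
  qed
  then show "bounded (range (\<lambda>x. norm x ^ k *\<^sub>R (u x * cnj (v x))))"
    by (auto simp: bounded_iff)
qed

lemma differentiable_has_vector_derivative_pderiv_at: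
  assumes "f differentiable (at (x + t *\<^sub>R axis i 1))"
  shows "((\<lambda>t. f (x + t *\<^sub>R axis i 1)) has_vector_derivative pderiv_at i f (x + t *\<^sub>R axis i 1)) (at t)"
proof -
  let ?l = "\<lambda>t. x + t *\<^sub>R axis i 1"
  have f: "(f has_derivative frechet_derivative f (at (?l t))) (at (?l t))"
    using assms frechet_derivative_works by blast
  have l: "(?l has_derivative (\<lambda>h. h *\<^sub>R axis i 1)) (at t)"
    by (auto intro!: derivative_eq_intros)
  have "((\<lambda>t. f (?l t)) has_derivative (\<lambda>h. frechet_derivative f (at (?l t)) (h *\<^sub>R axis i 1))) (at t)"
    using has_derivative_compose[OF l f] .
  then show ?thesis
    unfolding has_vector_derivative_def pderiv_at_def
    using linear_scale[OF linear_frechet_derivative[OF assms]] by simp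
qed

text \<open>Each coordinate contributes a pure derivative: with subscripts for partial derivatives,
  u_ii cnj(v) - u cnj(v_ii) is the i-th partial derivative of u_i cnj(v) - u cnj(v_i), as the terms
  u_i cnj(v_i) cancel.\<close>

lemma green_identity_schwartz:
  fixes u v :: "real^'n::finite \<Rightarrow> complex"
  assumes "schwartz u" "schwartz v"
  shows "integrable lborel (\<lambda>x. laplacian u x * cnj (v x) - u x * cnj (laplacian v x))" (is ?int)
    and "(LINT x|lborel. laplacian u x * cnj (v x) - u x * cnj (laplacian v x)) = 0" (is ?eq)
proof -
  note s = assms schwartz_pderiv_at
  define D where "D = (\<lambda>i x. pderiv_at i (pderiv_at i u) x * cnj (v x)
    - u x * cnj (pderiv_at i (pderiv_at i v) x))"
  have sum: "(\<lambda>x. laplacian u x * cnj (v x) - u x * cnj (laplacian v x)) = (\<lambda>x. \<Sum>i\<in>UNIV. D i x)"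
    by (simp add: D_def laplacian_def sum_subtractf sum_distrib_left sum_distrib_right)
  have intD: "integrable lborel (D i)" for i
    unfolding D_def by (intro Bochner_Integration.integrable_diff schwartz_integrable_mult_cnj s)
  have "(LINT x|lborel. D i x) = 0" for i
  proof (rule integral_directional_derivative_eq_0)
    let ?F = "\<lambda>x. pderiv_at i u x * cnj (v x) - u x * cnj (pderiv_at i v x)"
    show "integrable lborel ?F"
      by (intro Bochner_Integration.integrable_diff schwartz_integrable_mult_cnj s)
    show "integrable lborel (D i)" by (rule intD)
    show "continuous_on UNIV (D i)"
      unfolding D_def by (intro continuous_intros schwartz_continuous_on s)
    fix x t
    show "((\<lambda>t. ?F (x + t *\<^sub>R axis i 1)) has_vector_derivative D i (x + t *\<^sub>R axis i 1)) (at t)"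
      unfolding D_def
      by (auto intro!: derivative_eq_intros has_vector_derivative_cnj
          differentiable_has_vector_derivative_pderiv_at schwartz_differentiable s)
  qed
  then show ?int ?eq
    unfolding sum using intD by (simp_all add: integral_sum integrable_sum)
qed

section \<open>Symmetry of the operators\<close>

text \<open>Here \<open>a *\<^sub>R p\<close> and \<open>b *\<^sub>R q\<close> stand for the images
  of \<open>f\<close> and \<open>g\<close> under one of the operators. Since \<open>V\<close> is
  arbitrary, integrability of these images is drawn from \<open>p\<close> and \<open>q\<close> being
  Schwartz, which the eigenvalue equations will provide.\<close>

lemma inner_prod_eq_if_laplacian_defect:
  fixes f g p q :: "real^'n::finite \<Rightarrow> complex^2"
  assumes f: "\<And>j. schwartz (\<lambda>x. f x $ j)" and g: "\<And>j. schwartz (\<lambda>x. g x $ j)"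
    and p: "\<And>j. schwartz (\<lambda>x. p x $ j)" and q: "\<And>j. schwartz (\<lambda>x. q x $ j)"
    and defect: "\<And>x. (\<Sum>j\<in>UNIV. a *\<^sub>R p x $ j * cnj (g x $ j) - f x $ j * cnj (b *\<^sub>R q x $ j))
      = (\<Sum>j\<in>UNIV. c * (laplacian (\<lambda>y. f y $ j) x * cnj (g x $ j)
          - f x $ j * cnj (laplacian (\<lambda>y. g y $ j) x)))"
  shows "a * inner_prod p g = b * inner_prod f q"
proof -
  note pg = schwartz_integrable_mult_cnj[OF p g] and fq = schwartz_integrable_mult_cnj[OF f q]
  \<comment> \<open>\<open>lebesgue\<close> is the completion of \<open>lborel\<close>, and the two
    integrals agree on Borel measurable integrands.\<close>
  have lborel: "inner_prod u v = (\<Sum>j\<in>UNIV. LINT x|lborel. u x $ j * cnj (v x $ j))"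
    if "\<And>j. integrable lborel (\<lambda>x. u x $ j * cnj (v x $ j))" for u v :: "real^'n \<Rightarrow> complex^2"
    unfolding inner_prod_def
    using integral_completion[OF borel_measurable_integrable[OF that]] by simp
  have "a * inner_prod p g - b * inner_prod f q
      = (\<Sum>j\<in>UNIV. LINT x|lborel. a * (p x $ j * cnj (g x $ j)) - b * (f x $ j * cnj (q x $ j)))"
    using pg fq by (simp add: lborel sum_distrib_left sum_subtractf)
  also have "\<dots> = (LINT x|lborel. (\<Sum>j\<in>UNIV. a * (p x $ j * cnj (g x $ j)) - b * (f x $ j * cnj (q x $ j))))"
    using pg fq by (intro Bochner_Integration.integral_sum[symmetric]) simp
  also have "\<dots> = (LINT x|lborel. (\<Sum>j\<in>UNIV. c * (laplacian (\<lambda>y. f y $ j) x * cnj (g x $ j)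
          - f x $ j * cnj (laplacian (\<lambda>y. g y $ j) x))))"
    using defect by (simp add: scaleR_conv_of_real algebra_simps)
  also have "\<dots> = 0"
    using green_identity_schwartz[OF f g] by (simp add: integral_sum)
  finally show ?thesis by simp
qed

text \<open>The zeroth-order coefficients form a real matrix, symmetric because the two off-diagonal
  entries of \<beta> agree, so they cancel. Subtracting the real symmetric \<open>B_op\<close>
  instead of adding it preserves this, whence the twin lemma for \<open>H_minus\<close>.\<close>

lemma H_plus_laplacian_defect:
  assumes "\<beta> $ 1 $ 2 = \<beta> $ 2 $ 1"
  shows "(\<Sum>j\<in>UNIV. H_plus V \<delta> \<Omega> \<beta> \<phi> \<mu> f x $ j * cnj (g x $ j) - f x $ j * cnj (H_plus V \<delta> \<Omega> \<beta> \<phi> \<mu> g x $ j))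
    = (\<Sum>j\<in>UNIV. (- 1 / 2) * (laplacian (\<lambda>y. f y $ j) x * cnj (g x $ j)
        - f x $ j * cnj (laplacian (\<lambda>y. g y $ j) x)))"
  by (simp add: H_plus_def A_op_def B_op_def L1_op_def L2_op_def sum_2 assms algebra_simps)

lemma H_minus_laplacian_defect:
  assumes "\<beta> $ 1 $ 2 = \<beta> $ 2 $ 1"
  shows "(\<Sum>j\<in>UNIV. H_minus V \<delta> \<Omega> \<beta> \<phi> \<mu> f x $ j * cnj (g x $ j) - f x $ j * cnj (H_minus V \<delta> \<Omega> \<beta> \<phi> \<mu> g x $ j))
    = (\<Sum>j\<in>UNIV. (- 1 / 2) * (laplacian (\<lambda>y. f y $ j) x * cnj (g x $ j)
        - f x $ j * cnj (laplacian (\<lambda>y. g y $ j) x)))"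
  by (simp add: H_minus_def A_op_def B_op_def L1_op_def L2_op_def sum_2 assms algebra_simps)

section \<open>Orthogonality of the eigenpairs\<close>

lemma inner_prod_commute: "inner_prod g f = cnj (inner_prod f g)"
  by (simp add: inner_prod_def mult.commute flip: Bochner_Integration.integral_cnj)

lemma block_eigenpairD:
  assumes "block_eigenpair V \<delta> \<Omega> \<beta> \<phi> \<mu> \<omega> f g"
  shows "H_minus V \<delta> \<Omega> \<beta> \<phi> \<mu> g x = \<omega> *\<^sub>R f x" "H_plus V \<delta> \<Omega> \<beta> \<phi> \<mu> f x = \<omega> *\<^sub>R g x"
  using assms by (simp_all add: block_eigenpair_def block_op_def fun_eq_iff)

theorem theorem3:
  fixes V :: "real^'n::finite \<Rightarrow> real"
    and \<delta> \<Omega> \<mu> \<omega>\<^sub>1 \<omega>\<^sub>2 :: real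
    and \<beta> :: "real^2^2"
    and \<phi> :: "real^'n \<Rightarrow> real^2"
    and f\<^sub>1 g\<^sub>1 f\<^sub>2 g\<^sub>2 :: "real^'n \<Rightarrow> complex^2"
  assumes "CARD('n) \<in> {1, 2, 3}"
    and "\<Omega> \<noteq> 0"
    and "\<beta> $ 1 $ 2 = \<beta> $ 2 $ 1"
    and "\<And>j. schwartz (\<lambda>x. \<phi> x $ j)"
    and "ground_state V \<delta> \<Omega> \<beta> (complexify \<phi>)"
    and "chemical_potential V \<delta> \<Omega> \<beta> \<phi> \<mu>"
    and "\<And>j. schwartz (\<lambda>x. f\<^sub>1 x $ j)" and "\<And>j. schwartz (\<lambda>x. g\<^sub>1 x $ j)"
    and "\<And>j. schwartz (\<lambda>x. f\<^sub>2 x $ j)" and "\<And>j. schwartz (\<lambda>x. g\<^sub>2 x $ j)"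
    and "block_eigenpair V \<delta> \<Omega> \<beta> \<phi> \<mu> \<omega>\<^sub>1 f\<^sub>1 g\<^sub>1"
    and "block_eigenpair V \<delta> \<Omega> \<beta> \<phi> \<mu> \<omega>\<^sub>2 f\<^sub>2 g\<^sub>2"
    and "\<bar>\<omega>\<^sub>1\<bar> \<noteq> \<bar>\<omega>\<^sub>2\<bar>"
  shows "inner_prod f\<^sub>1 g\<^sub>2 = 0 \<and> inner_prod f\<^sub>2 g\<^sub>1 = 0"
proof -
  note eigen = block_eigenpairD[OF assms(11)] block_eigenpairD[OF assms(12)]
  let ?P = "inner_prod f\<^sub>1 g\<^sub>2" and ?Q = "inner_prod g\<^sub>1 f\<^sub>2"
  \<comment> \<open>\<open>H_minus\<close> sends \<open>g\<^sub>1\<close>, \<open>g\<^sub>2\<close>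
    to multiples of \<open>f\<^sub>1\<close>, \<open>f\<^sub>2\<close>, which play the roles of
    \<open>p\<close> and \<open>q\<close>; for \<open>H_plus\<close> below, the roles of the f's and
    g's are exchanged.\<close>
  have 1: "\<omega>\<^sub>1 * ?P = \<omega>\<^sub>2 * ?Q"
    using H_minus_laplacian_defect[OF assms(3), of V \<delta> \<Omega> \<phi> \<mu> g\<^sub>1 _ g\<^sub>2] assms(7-10)
    by (intro inner_prod_eq_if_laplacian_defect[where c = "- 1 / 2"]) (simp_all add: eigen)
  have 2: "\<omega>\<^sub>1 * ?Q = \<omega>\<^sub>2 * ?P"
    using H_plus_laplacian_defect[OF assms(3), of V \<delta> \<Omega> \<phi> \<mu> f\<^sub>1 _ f\<^sub>2] assms(7-10)
    by (intro inner_prod_eq_if_laplacian_defect[where c = "- 1 / 2"]) (simp_all add: eigen)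
  have "\<omega>\<^sub>1\<^sup>2 \<noteq> \<omega>\<^sub>2\<^sup>2"
    using assms(13) by (simp add: power2_eq_iff abs_eq_iff)
  then have det: "complex_of_real (\<omega>\<^sub>1\<^sup>2 - \<omega>\<^sub>2\<^sup>2) \<noteq> 0"
    by (simp del: of_real_diff)
  \<comment> \<open>Elimination: both products on the right equal
    \<open>\<omega>\<^sub>1 * \<omega>\<^sub>2 * ?Q\<close>, the first by \<open>1\<close> and the
    second by \<open>2\<close>.\<close>
  have "complex_of_real (\<omega>\<^sub>1\<^sup>2 - \<omega>\<^sub>2\<^sup>2) * ?P = \<omega>\<^sub>1 * (\<omega>\<^sub>1 * ?P) - \<omega>\<^sub>2 * (\<omega>\<^sub>2 * ?P)"
    by (simp add: power2_eq_square algebra_simps)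
  also have "\<dots> = 0" by (simp add: 1 flip: 2)
  finally have "?P = 0" using det by simp
  have "complex_of_real (\<omega>\<^sub>1\<^sup>2 - \<omega>\<^sub>2\<^sup>2) * ?Q = \<omega>\<^sub>1 * (\<omega>\<^sub>1 * ?Q) - \<omega>\<^sub>2 * (\<omega>\<^sub>2 * ?Q)"
    by (simp add: power2_eq_square algebra_simps)
  also have "\<dots> = 0" by (simp add: 2 flip: 1)
  finally have "?Q = 0" using det by simp
  \<comment> \<open>The second claimed inner product is the complex conjugate of
    \<open>?Q\<close>.\<close>
  then show ?thesis
    using \<open>?P = 0\<close> inner_prod_commute[of f\<^sub>2 g\<^sub>1] by simp
qed

end
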